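(* Let $d>2$ be a divisor of $E$ and let $s\in\mathcal{B}_d$. Then the norms (from $\mathbb{F}_q(x)$ to $\mathbb{F}_q$) of the zeros $x$ of $g_s(y)$ are nonsquares in $\mathbb{F}_q$; and when $d$ is odd, the norms (from $\mathbb{F}_q(x)$ to $\mathbb{F}_q$) of the zeros $x$ of $g_{-s}(y)$ are squares in $\mathbb{F}_q$.
   Context: $\mathbb{F}_q$ is a finite field with $q$ elements, $q$ a power of an odd prime; $n=(q+1)/2$; for $s\in\mathbb{F}_q$, $g_s(y) := y^n+(1-y)^n-s \in \mathbb{F}_q[y]$; zeros are taken in an algebraic closure of $\mathbb{F}_q$. $\rho$ is the quadratic character on $\mathbb{F}_q$, and $E := (q-\rho(-1))/2$, an even integer. $i\in\mathbb{F}_{q^2}$ is a fixed square root of $-1$. For a divisor $d>2$ of $E$, choose an arbitrary element $\zeta\in\mathbb{F}_q[i]$ of multiplicative order $2d$, and set $$\mathcal{B}_d := \{(\zeta^j+\zeta^{-j})/2 : 0<j<d,\ \gcd(j,2d)=1\}\subset\mathbb{F}_q.$$ (Equivalently, $\mathcal{B}_d$ is the set of all $(\beta+\beta^{-1})/2$ with $\beta\in\mathbb{F}_q[i]$ of order $2d$.) For $s\in\mathcal{B}_d$, all zeros of $g_s(y)$ and of $g_{-s}(y)$ have degree $d$ over $\mathbb{F}_q$. *)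

theory Defs
  imports
    "HOL-Algebra.Algebraic_Closure_Type"
    "HOL-Algebra.Generated_Fields"
    "HOL-Algebra.Multiplicative_Group"
    "HOL-Library.Cardinality"
    "HOL-Computational_Algebra.Nth_Powers"
    "Jordan_Normal_Form.Determinant"
begin

text \<open>
  Throughout, \<open>'a\<close> is the finite field \<open>F\<^sub>q\<close>, \<open>q = CARD('a)\<close>, and \<open>'a alg_closure\<close> is its
  algebraic closure, into which \<open>F\<^sub>q\<close> is embedded by \<open>to_ac\<close>.
\<close>

subsection \<open>Simple extensions and the norm\<close>

definition adjoin :: "'a::field alg_closure \<Rightarrow> 'a alg_closure set" where
  "adjoin x = generate_field ring_of_type_algebra (insert x (range to_ac))"

interpretation ac: vector_space "\<lambda>(c::'a::field) (z::'a alg_closure). to_ac c * z"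
  by unfold_locales (simp_all add: algebra_simps)

definition adjoin_basis :: "'a::field alg_closure \<Rightarrow> 'a alg_closure list \<Rightarrow> bool" where
  "adjoin_basis x bs \<longleftrightarrow>
     distinct bs \<and> ac.independent (set bs) \<and> ac.span (set bs) = adjoin x"

text \<open>Column \<open>j\<close> holds the coordinates of \<open>x * bs ! j\<close> with respect to the basis \<open>bs\<close>.\<close>

definition mult_matrix :: "'a::field alg_closure \<Rightarrow> 'a alg_closure list \<Rightarrow> 'a mat" where
  "mult_matrix x bs = mat (length bs) (length bs)
     (\<lambda>(i, j). ac.representation (set bs) (x * bs ! j) (bs ! i))"

text \<open>
  The norm of \<open>x\<close> from \<open>F(x)\<close> to \<open>F\<close> is the determinant of the \<open>F\<close>-linear map \<open>z \<mapsto> x * z\<close> on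
  \<open>F(x)\<close>. A basis exists because \<open>x\<close> is algebraic over \<open>F\<close>, and the determinant does not
  depend on its choice.
\<close>

definition norm_adjoin :: "'a::field alg_closure \<Rightarrow> 'a" where
  "norm_adjoin x = det (mult_matrix x (SOME bs. adjoin_basis x bs))"

subsection \<open>The polynomials and the parameter sets\<close>

definition mult_ord :: "'b::field \<Rightarrow> nat" where
  "mult_ord z = group.ord (Multiplicative_Group.mult_of (ring_of_type_algebra :: 'b ring)) z"

definition quad_char :: "'a::field \<Rightarrow> int" where
  "quad_char a = (if a = 0 then 0 else if is_square a then 1 else -1)"

definition E_param :: "'a::{field,finite} itself \<Rightarrow> int" where
  "E_param _ = (int CARD('a) - quad_char (-1::'a)) div 2"

definition g_poly :: "'a::{field,finite} \<Rightarrow> 'a poly" where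
  "g_poly s = (let n = (CARD('a) + 1) div 2; y = [:0, 1:] in y ^ n + (1 - y) ^ n - [:s:])"

abbreviation g_zero :: "'a::{field,finite} \<Rightarrow> 'a alg_closure \<Rightarrow> bool" where
  "g_zero s x \<equiv> poly (map_poly to_ac (g_poly s)) x = 0"

text \<open>
  For \<open>\<zeta>\<close> as in the theorem, the elements \<open>(\<zeta>\<^sup>j + \<zeta>\<^sup>-\<^sup>j) / 2\<close> of the algebraic closure all lie in
  the image of \<open>F\<^sub>q\<close>; \<open>B_set\<close> is the set of their preimages.
\<close>

definition B_set :: "'a::{field,finite} alg_closure \<Rightarrow> nat \<Rightarrow> 'a set" where
  "B_set \<zeta> d = {s. \<exists>j. 0 < j \<and> j < d \<and> coprime j (2 * d) \<and>
                        to_ac s = (\<zeta> ^ j + inverse \<zeta> ^ j) / 2}"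

end

theory Submission
  imports Defs "HOL-Number_Theory.Residues"
begin

text \<open>
  Every \<open>x\<close> in the algebraic closure has the form \<open>(W + 1)\<^sup>2 / (4 W)\<close>, with \<open>W\<close> unique up to inversion; this
  is the parametrisation \<open>x = cos\<^sup>2 t\<close>, \<open>1 - x = sin\<^sup>2 t\<close> with \<open>W = exp (2 i t)\<close>. It turns \<open>x\<^sup>n + (1 - x)\<^sup>n\<close> into
  \<open>(W\<^sup>E + W\<^bsup>-E\<^esup>) / 2\<close> (lemma \<open>cosine_square_paramE\<close>). For \<open>s = (\<beta> + \<beta>\<^sup>-\<^sup>1) / 2\<close>, the zeros of \<open>g\<^sub>s\<close> are therefore
  given by \<open>W\<^sup>E = \<beta>\<close>, up to inversion of \<open>W\<close>. Let \<open>\<beta>\<^sup>2\<close> have order \<open>d\<close>.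

  As \<open>q = 2 E \<plusminus> 1\<close>, Frobenius sends \<open>W\<close> to \<open>\<beta>\<^sup>2 W\<close> or \<open>\<beta>\<^sup>2 W\<^sup>-\<^sup>1\<close>. Modulo inversion it multiplies \<open>W\<close> by an element
  \<open>g\<close> of order \<open>d\<close>, so \<open>x\<close> has exactly \<open>d\<close> conjugates, with the parameters \<open>g\<^sup>k W\<close>
  (lemma \<open>frobenius_orbit_cosine_square\<close>). Their product is computed from \<open>\<Prod>\<^sub>k (1 + g\<^sup>k W) = 1 - V\<close> with
  \<open>V = (- W)\<^sup>d\<close>: the norm of \<open>x\<close> is \<open>- (1 - V)\<^sup>2 / (4\<^sup>d V)\<close>. Frobenius multiplies a square root of this
  expression by \<open>(- V)\<^sup>E = \<beta>\<^sup>d = \<plusminus> 1\<close>, so the norm is a square if and only if \<open>\<beta>\<^sup>d = 1\<close>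
  (lemma \<open>is_square_norm_cosine_square_iff\<close>). For \<open>s \<in> B\<^sub>d\<close> the order of \<open>\<beta>\<close> is \<open>2 d\<close> and \<open>\<beta>\<^sup>d = -1\<close>; for \<open>- s\<close>
  and odd \<open>d\<close>, \<open>\<beta>\<close> is replaced by \<open>- \<beta>\<close> and \<open>(- \<beta>)\<^sup>d = 1\<close>.

  That the norm, a determinant, is the product of the conjugates is shown for any element with an orbit
  of \<open>d\<close> conjugates (lemma \<open>norm_adjoin_eq_prod\<close>), by diagonalising the multiplication map with the
  matrix of conjugates of a basis.
\<close>

section \<open>The Frobenius map on the algebraic closure\<close>

lemma card_finite_field_ge_2: "CARD('a::{field,finite}) \<ge> 2"
proof -
  have "card {0, 1::'a} \<le> CARD('a)"
    by (rule card_mono) auto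
  then show ?thesis
    by simp
qed

lemma power_CARD_eq_self: "(a::'a::{field,finite}) ^ CARD('a) = a"
proof (cases "a = 0")
  case False
  have "(\<Prod>b\<in>UNIV-{0}. b) = (\<Prod>b\<in>UNIV-{0}. a * b)"
    by (rule prod.reindex_bij_witness[of _ "\<lambda>b. a * b" "\<lambda>b. b / a"]) (use False in auto)
  also have "\<dots> = a ^ (CARD('a) - 1) * (\<Prod>b\<in>UNIV-{0}. b)"
    by (simp add: prod.distrib card_Diff_singleton)
  finally have "a ^ (CARD('a) - 1) = 1"
    by simp
  moreover have "a ^ CARD('a) = a * a ^ (CARD('a) - 1)"
    using card_finite_field_ge_2[where 'a='a] by (simp flip: power_Suc)
  ultimately show ?thesis
    by simp
qed (use card_finite_field_ge_2[where 'a='a] in auto)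

lemma card_range_to_ac: "card (range (to_ac :: 'a::{field,finite} \<Rightarrow> _)) = CARD('a)"
  by (simp add: card_image inj_to_ac)

lemma to_ac_power_CARD: "to_ac (a::'a::{field,finite}) ^ CARD('a) = to_ac a"
  by (metis to_ac_power power_CARD_eq_self)

text \<open>
  Both sides of
  \<open>(X + 1)\<^sup>q = X\<^sup>q + 1\<close> are monic of degree \<open>q\<close> and agree at the \<open>q\<close> points of the base field, so this is an
  identity of polynomials. Homogenising it gives additivity everywhere.
\<close>

lemma frobenius_add:
  fixes u v :: "'a::{field,finite} alg_closure"
  shows "(u + v) ^ CARD('a) = u ^ CARD('a) + v ^ CARD('a)"
proof (cases "v = 0")
  case True
  then show ?thesis
    using card_finite_field_ge_2[where 'a='a] by (simp add: power_0_left)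
next
  case False
  let ?q = "CARD('a)"
  have "[:1, 1:] ^ ?q = monom 1 ?q + (1 :: 'a alg_closure poly)"
  proof (rule poly_eqI_degree_lead_coeff[where n = ?q and A = "range to_ac"])
    show "coeff ([:1, 1:] ^ ?q) ?q = coeff (monom 1 ?q + (1 :: 'a alg_closure poly)) ?q"
      using card_finite_field_ge_2[where 'a='a]
      by (simp add: coeff_linear_power)
    show "degree ([:1, 1:: 'a alg_closure:] ^ ?q) \<le> ?q"
      by (rule order.trans[OF degree_power_le]) simp
    show "degree (monom 1 ?q + (1 :: 'a alg_closure poly)) \<le> ?q"
      by (intro degree_add_le order.trans[OF degree_monom_le]) simp_all
    fix z :: "'a alg_closure"
    assume "z \<in> range to_ac"
    then obtain a where a: "z = to_ac a"
      by auto
    have "(to_ac a + 1) ^ ?q = to_ac a + (1 :: 'a alg_closure)"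
      using to_ac_power_CARD[of "a + 1"] by simp
    then show "poly ([:1, 1:] ^ ?q) z = poly (monom 1 ?q + 1) z"
      using to_ac_power_CARD[of a] by (simp add: a poly_monom add.commute)
  qed (simp add: card_range_to_ac)
  from arg_cong[OF this, of "\<lambda>p. poly p (u / v)"]
  have "(u / v + 1) ^ ?q = (u / v) ^ ?q + 1"
    by (simp add: poly_monom add.commute)
  moreover have "u + v = (u / v + 1) * v"
    using False by (simp add: field_simps)
  ultimately have "(u + v) ^ ?q = ((u / v) ^ ?q + 1) * v ^ ?q"
    by (simp add: power_mult_distrib)
  then show ?thesis
    using False by (simp add: field_simps)
qed

text \<open>
  The base field already supplies the \<open>q\<close> roots that \<open>X\<^sup>q - X\<close> can have.
\<close>

lemma power_CARD_eq_self_iff: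
  fixes z :: "'a::{field,finite} alg_closure"
  shows "z ^ CARD('a) = z \<longleftrightarrow> z \<in> range to_ac"
proof -
  let ?q = "CARD('a)"
  let ?P = "monom 1 ?q - monom 1 1 :: 'a alg_closure poly"
  have q: "?q \<ge> 2"
    by (rule card_finite_field_ge_2)
  have "coeff ?P ?q = 1"
    using q by simp
  then have nz: "?P \<noteq> 0"
    by (metis coeff_0 zero_neq_one)
  have "degree ?P \<le> ?q"
    using q by (intro degree_diff_le order.trans[OF degree_monom_le]) auto
  then have "card {z. poly ?P z = 0} \<le> card (range (to_ac :: 'a \<Rightarrow> _))"
    using card_poly_roots_bound[OF nz] by (simp add: card_range_to_ac)
  moreover have "range to_ac \<subseteq> {z. poly ?P z = 0}"
    by (auto simp: poly_monom to_ac_power_CARD)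
  ultimately have "range to_ac = {z. poly ?P z = 0}"
    by (intro card_seteq poly_roots_finite nz)
  then show ?thesis
    by (auto simp: poly_monom)
qed

lemma frobenius_power_add:
  fixes u v :: "'a::{field,finite} alg_closure"
  shows "(u + v) ^ (CARD('a) ^ k) = u ^ (CARD('a) ^ k) + v ^ (CARD('a) ^ k)"
proof (induction k)
  case (Suc k)
  have "w ^ (CARD('a) ^ Suc k) = (w ^ (CARD('a) ^ k)) ^ CARD('a)" for w :: "'a alg_closure"
    by (simp add: mult.commute flip: power_mult)
  then show ?case
    by (simp only: Suc frobenius_add)
qed simp

lemma frobenius_power_sum:
  fixes f :: "'b \<Rightarrow> 'a::{field,finite} alg_closure"
  shows "(\<Sum>i\<in>I. f i) ^ (CARD('a) ^ k) = (\<Sum>i\<in>I. f i ^ (CARD('a) ^ k))"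
  by (induction I rule: infinite_finite_induct)
    (simp_all add: frobenius_power_add zero_power)

lemma to_ac_power_CARD_power: "to_ac (a::'a::{field,finite}) ^ (CARD('a) ^ k) = to_ac a"
  by (induction k) (simp_all add: power_mult to_ac_power_CARD)

lemma two_neq_0_if_odd_CARD:
  assumes "odd CARD('a::{field,finite})"
  shows "(2 :: 'a alg_closure) \<noteq> 0"
proof
  assume "(2 :: 'a alg_closure) = 0"
  then have "of_nat 2 = (0 :: 'a alg_closure)"
    by simp
  then have "CHAR('a) dvd 2"
    by (simp only: of_nat_eq_0_iff_char_dvd CHAR_alg_closure)
  moreover have "CHAR('a) \<noteq> 1"
    using CHAR_not_1' by auto
  ultimately have "CHAR('a) = 2"
    using prime_nat_iff two_is_prime_nat by blast
  then show False
    using CHAR_dvd_CARD[where 'a='a] assms by simp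
qed

text \<open>
  This takes the place of Euler's criterion: \<open>N\<close> is a square exactly when its square roots are rational,
  so a Frobenius action on an explicit square root decides the matter.
\<close>

lemma is_square_iff_root_frobenius_fixed:
  fixes N :: "'a::{field,finite}"
  assumes "M\<^sup>2 = to_ac N"
  shows "is_square N \<longleftrightarrow> M ^ CARD('a) = M"
proof
  assume "is_square N"
  then obtain b where "N = b\<^sup>2"
    by (auto simp: is_nth_power_def)
  then have "M\<^sup>2 = (to_ac b)\<^sup>2"
    using assms by simp
  then have "M = to_ac b \<or> M = to_ac (- b)"
    by (simp add: power2_eq_iff)
  then show "M ^ CARD('a) = M"
    using power_CARD_eq_self_iff by blast
next
  assume "M ^ CARD('a) = M"
  then obtain b where "M = to_ac b"
    using power_CARD_eq_self_iff by blast
  then have "to_ac (b\<^sup>2) = to_ac N"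
    using assms by simp
  then have "N = b\<^sup>2"
    by (metis to_ac_eq_iff)
  then show "is_square N"
    by simp
qed

section \<open>The norm as a product of conjugates\<close>

text \<open>
  The fixed points of a power of Frobenius form a field containing \<open>F\<^sub>q\<close>.
\<close>

lemma adjoin_subset_frobenius_fixed:
  fixes x :: "'a::{field,finite} alg_closure"
  assumes "x ^ (CARD('a) ^ d) = x"
  shows "adjoin x \<subseteq> {z. z ^ (CARD('a) ^ d) = z}"
proof
  interpret K: field "ring_of_type_algebra :: 'a alg_closure ring"
    by (rule field_from_type_algebra)
  fix z
  assume "z \<in> adjoin x"
  then have "z \<in> generate_field ring_of_type_algebra (insert x (range to_ac))"
    by (simp add: adjoin_def)
  then have "z ^ (CARD('a) ^ d) = z"
  proof (induction rule: generate_field.induct)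
    case one
    then show ?case by (simp add: ring_of_type_algebra_def)
  next
    case (incl h)
    then show ?case using assms to_ac_power_CARD_power by auto
  next
    case (a_inv h)
    have "h \<oplus>\<^bsub>ring_of_type_algebra\<^esub> \<ominus>\<^bsub>ring_of_type_algebra\<^esub> h = \<zero>\<^bsub>ring_of_type_algebra\<^esub>"
      by (rule K.r_neg) (simp add: ring_of_type_algebra_def)
    then have "\<ominus>\<^bsub>ring_of_type_algebra\<^esub> h = - h"
      by (simp add: ring_of_type_algebra_def eq_neg_iff_add_eq_0 add.commute)
    moreover have "(- h + h) ^ (CARD('a) ^ d) = (- h) ^ (CARD('a) ^ d) + h ^ (CARD('a) ^ d)"
      by (rule frobenius_power_add)
    ultimately show ?case
      using a_inv by (simp only:) (simp add: zero_power eq_neg_iff_add_eq_0)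
  next
    case (m_inv h)
    have "h \<otimes>\<^bsub>ring_of_type_algebra\<^esub> inv\<^bsub>ring_of_type_algebra\<^esub> h = \<one>\<^bsub>ring_of_type_algebra\<^esub>"
      using m_inv(2) by (intro K.Units_r_inv) (simp add: K.field_Units, simp add: ring_of_type_algebra_def)
    then have "h * inv\<^bsub>ring_of_type_algebra\<^esub> h = 1"
      by (simp add: ring_of_type_algebra_def)
    then have "inv\<^bsub>ring_of_type_algebra\<^esub> h = inverse h"
      by (metis inverse_unique)
    then show ?case
      using m_inv by (simp add: power_inverse)
  next
    case (eng_add h1 h2)
    then show ?case by (simp add: ring_of_type_algebra_def frobenius_power_add)
  next
    case (eng_mult h1 h2)
    then show ?case by (simp add: ring_of_type_algebra_def power_mult_distrib)
  qed
  then show "z \<in> {z. z ^ (CARD('a) ^ d) = z}"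
    by simp
qed

lemma ac_subspace_adjoin: "ac.subspace (adjoin x)"
proof (rule ac.subspaceI)
  show "0 \<in> adjoin x"
    unfolding adjoin_def by (rule generate_field.incl) (metis insertI2 rangeI to_ac_0)
  show "u + v \<in> adjoin x" if "u \<in> adjoin x" "v \<in> adjoin x" for u v
    using generate_field.eng_add[of u ring_of_type_algebra "insert x (range to_ac)" v] that
    by (simp add: adjoin_def ring_of_type_algebra_def)
  show "to_ac c * u \<in> adjoin x" if "u \<in> adjoin x" for c u
    using generate_field.eng_mult[of "to_ac c" ring_of_type_algebra "insert x (range to_ac)" u] that
      generate_field.incl[of "to_ac c" "insert x (range to_ac)" ring_of_type_algebra]
    by (simp add: adjoin_def ring_of_type_algebra_def)
qed

lemma power_in_adjoin: "x ^ l \<in> adjoin x"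
proof (induction l)
  case 0
  show ?case
    using generate_field.one[of ring_of_type_algebra "insert x (range to_ac)"]
    by (simp add: adjoin_def ring_of_type_algebra_def)
next
  case (Suc l)
  then show ?case
    using generate_field.eng_mult[of x ring_of_type_algebra "insert x (range to_ac)" "x ^ l"]
      generate_field.incl[of x "insert x (range to_ac)" ring_of_type_algebra]
    by (simp add: adjoin_def ring_of_type_algebra_def)
qed

lemma poly_sum_eq_0_imp_coeffs_0:
  fixes a :: "nat \<Rightarrow> 'b::idom"
  assumes "\<And>z. z \<in> A \<Longrightarrow> (\<Sum>l<d. a l * z ^ l) = 0" and "card A \<ge> d" and "l < d"
  shows "a l = 0"
proof -
  let ?P = "\<Sum>l<d. monom (a l) l"
  have coeff: "coeff ?P k = (if k < d then a k else 0)" for k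
    by (simp add: coeff_sum)
  have "d > 0"
    using assms(3) by simp
  have "?P = 0"
  proof (rule poly_eqI_degree[where A = A])
    have "degree ?P < d"
      using \<open>d > 0\<close> by (intro degree_lessI) (auto simp: coeff)
    then show "card A > degree ?P"
      using assms(2) by simp
    show "card A > degree (0 :: 'b poly)"
      using assms(2) \<open>d > 0\<close> by simp
  qed (use assms(1) in \<open>simp add: poly_sum poly_monom\<close>)
  then show ?thesis
    using coeff[of l] assms(3) by simp
qed

text \<open>
  An element with exactly \<open>d\<close> conjugates. The degree of the field that it generates, and then its
  norm, come from comparing cardinalities of finite sets with degrees of polynomials.
\<close>

locale frobenius_orbit =
  fixes x :: "'a::{field,finite} alg_closure" and d :: nat
  assumes d_pos: "d > 0"
    and period: "x ^ (CARD('a) ^ d) = x"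
    and inj: "inj_on (\<lambda>k. x ^ (CARD('a) ^ k)) {..<d}"
begin

text \<open>
  A relation of degree less than \<open>d\<close> between the powers of \<open>x\<close> would also hold for all \<open>d\<close> conjugates,
  which are too many roots for a polynomial of that degree.
\<close>

lemma inj_on_combinations_of_powers:
  "inj_on (\<lambda>f. \<Sum>l<d. to_ac (f l) * x ^ l) ({..<d} \<rightarrow>\<^sub>E (UNIV :: 'a set))"
proof (rule inj_onI)
  fix f g :: "nat \<Rightarrow> 'a"
  assume f: "f \<in> {..<d} \<rightarrow>\<^sub>E UNIV" and g: "g \<in> {..<d} \<rightarrow>\<^sub>E UNIV"
    and eq: "(\<Sum>l<d. to_ac (f l) * x ^ l) = (\<Sum>l<d. to_ac (g l) * x ^ l)"
  have conj: "(\<Sum>l<d. to_ac (h l) * x ^ l) ^ (CARD('a) ^ k) =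
      (\<Sum>l<d. to_ac (h l) * (x ^ (CARD('a) ^ k)) ^ l)" for h :: "nat \<Rightarrow> 'a" and k
    by (simp add: frobenius_power_sum power_mult_distrib to_ac_power_CARD_power
        power_mult[symmetric] mult.commute[of "CARD('a) ^ k"])
  have "to_ac (f l - g l) = 0" if "l < d" for l
  proof (rule poly_sum_eq_0_imp_coeffs_0[where A = "(\<lambda>k. x ^ (CARD('a) ^ k)) ` {..<d}"])
    show "card ((\<lambda>k. x ^ (CARD('a) ^ k)) ` {..<d}) \<ge> d"
      by (simp add: card_image inj)
    fix z
    assume "z \<in> (\<lambda>k. x ^ (CARD('a) ^ k)) ` {..<d}"
    then obtain k where k: "z = x ^ (CARD('a) ^ k)"
      by auto
    show "(\<Sum>l<d. to_ac (f l - g l) * z ^ l) = 0"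
      using conj[of f k] conj[of g k] eq by (simp add: k algebra_simps sum_subtractf)
  qed (rule that)
  then show "f = g"
    using f g by (intro PiE_ext[of f _ _ g]) auto
qed

text \<open>
  Three nested sets are squeezed: the combinations of \<open>1, x, \<dots>, x\<^bsup>d - 1\<^esup>\<close> are \<open>q\<^sup>d\<close> elements of \<open>F\<^sub>q(x)\<close>,
  which lies in the fixed set of the \<open>d\<close>-th Frobenius power, and this set has at most \<open>q\<^sup>d\<close> elements because it
  consists of the roots of a polynomial of that degree.
\<close>

lemma adjoin_eq_span_powers: "adjoin x = ac.span ((\<lambda>l. x ^ l) ` {..<d})" (is ?span)
  and adjoin_eq_frobenius_fixed: "adjoin x = {z. z ^ (CARD('a) ^ d) = z}" (is ?fixed)
  and card_adjoin: "card (adjoin x) = CARD('a) ^ d" (is ?card)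
proof -
  let ?S = "(\<lambda>f. \<Sum>l<d. to_ac (f l) * x ^ l) ` ({..<d} \<rightarrow>\<^sub>E (UNIV :: 'a set))"
  let ?Q = "CARD('a) ^ d"
  let ?P = "monom 1 ?Q - monom 1 1 :: 'a alg_closure poly"
  have Q: "?Q > 1"
    using card_finite_field_ge_2[where 'a='a] d_pos by (intro one_less_power) auto
  have "coeff ?P ?Q = 1"
    using Q by simp
  then have nz: "?P \<noteq> 0"
    by (metis coeff_0 zero_neq_one)
  have "degree ?P \<le> ?Q"
    using Q by (intro degree_diff_le order.trans[OF degree_monom_le]) auto
  moreover have fixed: "{z. poly ?P z = 0} = {z :: 'a alg_closure. z ^ ?Q = z}"
    by (simp add: poly_monom)
  ultimately have fin: "finite {z :: 'a alg_closure. z ^ ?Q = z}"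
    and le: "card {z :: 'a alg_closure. z ^ ?Q = z} \<le> ?Q"
    using card_poly_roots_bound[OF nz] poly_roots_finite[OF nz] by auto
  have card_S: "card ?S = ?Q"
    by (simp add: card_image inj_on_combinations_of_powers card_PiE)
  have 1: "?S \<subseteq> ac.span ((\<lambda>l. x ^ l) ` {..<d})"
    by (auto intro!: ac.span_sum ac.span_scale intro: ac.span_base)
  have 2: "ac.span ((\<lambda>l. x ^ l) ` {..<d}) \<subseteq> adjoin x"
    by (rule ac.span_minimal) (auto simp: power_in_adjoin ac_subspace_adjoin)
  have 3: "adjoin x \<subseteq> {z. z ^ ?Q = z}"
    by (rule adjoin_subset_frobenius_fixed[OF period])
  have "?S = {z. z ^ ?Q = z}"
    using 1 2 3 fin le card_S by (intro card_seteq) auto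
  then show ?span ?fixed
    using 1 2 3 by auto
  then show ?card
    using card_S \<open>?S = {z. z ^ ?Q = z}\<close> by simp
qed

lemma adjoin_basis_exists: "\<exists>bs. adjoin_basis x bs"
proof -
  obtain B where B: "B \<subseteq> adjoin x" "ac.independent B" "adjoin x \<subseteq> ac.span B"
    using ac.maximal_independent_subset by blast
  have "finite B"
    using ac.independent_span_bound[of "(\<lambda>l. x ^ l) ` {..<d}" B] B adjoin_eq_span_powers by simp
  then obtain bs where "set bs = B" "distinct bs"
    using finite_distinct_list by blast
  then show ?thesis
    using B ac.span_minimal[OF B(1) ac_subspace_adjoin] by (auto simp: adjoin_basis_def)
qed

text \<open>
  The exchange lemma bounds the length by the number of spanning powers; conversely \<open>m\<close> coordinates
  distinguish at most \<open>q ^ m\<close> of the \<open>q ^ d\<close> elements.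
\<close>

lemma length_adjoin_basis:
  assumes "adjoin_basis x bs"
  shows "length bs = d"
proof (rule antisym)
  have len: "length bs = card (set bs)"
    using assms by (simp add: adjoin_basis_def distinct_card)
  have "card (set bs) \<le> card ((\<lambda>l. x ^ l) ` {..<d})"
    using assms ac.independent_span_bound[of "(\<lambda>l. x ^ l) ` {..<d}" "set bs"]
      ac.span_superset[of "set bs"]
    by (simp add: adjoin_basis_def adjoin_eq_span_powers)
  also have "\<dots> \<le> d"
    using card_image_le[of "{..<d}"] by simp
  finally show "length bs \<le> d"
    by (simp add: len)
  let ?c = "\<lambda>u. \<Sum>b\<in>set bs. to_ac (u b) * b"
  have "adjoin x \<subseteq> ?c ` (set bs \<rightarrow>\<^sub>E (UNIV :: 'a set))"
  proof
    fix z
    assume "z \<in> adjoin x"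
    then obtain u where "z = ?c u"
      using assms ac.span_finite[of "set bs"] by (auto simp: adjoin_basis_def)
    then have "z = ?c (restrict u (set bs))"
      by simp
    moreover have "restrict u (set bs) \<in> set bs \<rightarrow>\<^sub>E (UNIV :: 'a set)"
      by (rule restrict_PiE_iff[THEN iffD2]) simp
    ultimately show "z \<in> ?c ` (set bs \<rightarrow>\<^sub>E (UNIV :: 'a set))"
      by (rule image_eqI)
  qed
  moreover have fin: "finite (set bs \<rightarrow>\<^sub>E (UNIV :: 'a set))"
    by (rule finite_PiE) simp_all
  ultimately have "card (adjoin x) \<le> card (?c ` (set bs \<rightarrow>\<^sub>E (UNIV :: 'a set)))"
    by (intro card_mono finite_imageI)
  also have "\<dots> \<le> card (set bs \<rightarrow>\<^sub>E (UNIV :: 'a set))"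
    by (rule card_image_le[OF fin])
  also have "\<dots> = CARD('a) ^ length bs"
    by (simp add: card_PiE len)
  finally have "CARD('a) ^ d \<le> CARD('a) ^ length bs"
    by (simp only: card_adjoin)
  moreover have "1 < CARD('a)"
    using card_finite_field_ge_2[where 'a='a] by simp
  ultimately show "d \<le> length bs"
    by (rule power_le_imp_le_exp[rotated])
qed

text \<open>
  The polynomial \<open>\<Sum>\<^sub>k c\<^sub>k X ^ (q ^ k)\<close> has degree below \<open>q\<^sup>d\<close> but vanishes on all of \<open>F\<^sub>q(x)\<close>.
\<close>

lemma frobenius_powers_independent:
  assumes "\<And>z. z \<in> adjoin x \<Longrightarrow> (\<Sum>k<d. c k * z ^ (CARD('a) ^ k)) = 0" and "k < d"
  shows "c k = 0"
proof -
  let ?P = "\<Sum>k<d. monom (c k) (CARD('a) ^ k)"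
  have q: "CARD('a) > 1"
    using card_finite_field_ge_2[where 'a='a] by simp
  have "?P = 0"
  proof (rule poly_eqI_degree[where A = "adjoin x"])
    have "degree (monom (c j) (CARD('a) ^ j)) \<le> CARD('a) ^ (d - 1)" if "j < d" for j
      using q that by (intro order.trans[OF degree_monom_le] power_increasing) auto
    then have "degree ?P \<le> CARD('a) ^ (d - 1)"
      by (intro degree_sum_le) auto
    also have "\<dots> < CARD('a) ^ d"
      using q d_pos by (intro power_strict_increasing) auto
    finally show "card (adjoin x) > degree ?P"
      by (simp add: card_adjoin)
    then show "card (adjoin x) > degree (0 :: 'a alg_closure poly)"
      by simp
  qed (use assms(1) in \<open>simp add: poly_sum poly_monom\<close>)
  moreover have "coeff ?P (CARD('a) ^ k) = (\<Sum>j<d. if j = k then c j else 0)"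
    using q by (simp add: coeff_sum power_inject_exp)
  ultimately show ?thesis
    using assms(2) by simp
qed

text \<open>
  Applying the \<open>k\<close>-th Frobenius power to \<open>x b\<^sub>j = \<Sum>\<^sub>i M\<^sub>i\<^sub>j b\<^sub>i\<close> for \<open>k < d\<close> gives \<open>D B = B M\<close>, with \<open>D\<close> the diagonal
  matrix of the conjugates of \<open>x\<close> and \<open>B\<close> the matrix of the conjugates of the basis. As \<open>B\<close> is invertible,
  \<open>M\<close> and \<open>D\<close> have the same determinant, whichever basis is used.
\<close>

lemma det_mult_matrix:
  assumes bs: "adjoin_basis x bs"
  shows "to_ac (det (mult_matrix x bs)) = (\<Prod>k<d. x ^ (CARD('a) ^ k))"
proof -
  interpret to_ac: comm_ring_hom "to_ac :: 'a \<Rightarrow> 'a alg_closure"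
    by unfold_locales auto
  have len: "length bs = d"
    by (rule length_adjoin_basis[OF bs])
  have ind: "ac.independent (set bs)" and span: "ac.span (set bs) = adjoin x" and dist: "distinct bs"
    using bs by (auto simp: adjoin_basis_def)
  have mem: "bs ! j \<in> adjoin x" if "j < d" for j
    using that ac.span_superset[of "set bs"] by (auto simp: len span)
  define D where "D = mat d d (\<lambda>(k, j). if k = j then x ^ (CARD('a) ^ k) else 0)"
  define B where "B = mat d d (\<lambda>(k, j). (bs ! j) ^ (CARD('a) ^ k))"
  define M where "M = map_mat to_ac (mult_matrix x bs)"
  have D: "D \<in> carrier_mat d d" and B: "B \<in> carrier_mat d d" and M: "M \<in> carrier_mat d d"
    by (auto simp: D_def B_def M_def mult_matrix_def len)
  have "D * B = B * M"
  proof (rule eq_matI)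
    fix k j
    assume "k < dim_row (B * M)" "j < dim_col (B * M)"
    then have k: "k < d" and j: "j < d"
      using B M by auto
    have "x * bs ! j \<in> ac.span (set bs)"
      using mem[OF j] power_in_adjoin[of x 1]
      by (simp add: span adjoin_eq_frobenius_fixed power_mult_distrib)
    then have "x * bs ! j =
        (\<Sum>b\<in>set bs. to_ac (ac.representation (set bs) (x * bs ! j) b) * b)"
      using ac.sum_representation_eq[OF ind, of "x * bs ! j" "set bs"] by simp
    also have "\<dots> = (\<Sum>i<d. to_ac (ac.representation (set bs) (x * bs ! j) (bs ! i)) * bs ! i)"
      using dist len by (intro sum.reindex_bij_betw[symmetric] bij_betw_nth) auto
    finally have "(x * bs ! j) ^ (CARD('a) ^ k) = (\<Sum>i<d.
        to_ac (ac.representation (set bs) (x * bs ! j) (bs ! i)) * (bs ! i) ^ (CARD('a) ^ k))"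
      by (metis (no_types, lifting) frobenius_power_sum power_mult_distrib sum.cong
          to_ac_power_CARD_power)
    moreover have "(D * B) $$ (k, j) = (x * bs ! j) ^ (CARD('a) ^ k)"
      using k j by (simp add: D_def B_def scalar_prod_def power_mult_distrib if_distrib[of "\<lambda>a. a * _"]
          cong: if_cong)
    moreover have "(B * M) $$ (k, j) = (\<Sum>i<d.
        to_ac (ac.representation (set bs) (x * bs ! j) (bs ! i)) * (bs ! i) ^ (CARD('a) ^ k))"
      using k j by (simp add: M_def B_def mult_matrix_def len scalar_prod_def mult.commute
          atLeast0LessThan)
    ultimately show "(D * B) $$ (k, j) = (B * M) $$ (k, j)"
      by simp
  qed (use D B M in auto)
  then have "det D * det B = det M * det B"
    using det_mult[OF D B] det_mult[OF B M] by (metis mult.commute)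
  moreover have "det B \<noteq> 0"
  proof
    assume "det B = 0"
    then have "det (transpose_mat B) = 0"
      by (simp add: det_transpose[OF B])
    \<comment> \<open>A dependency between the rows of B is a dependency between the Frobenius powers.\<close>
    then obtain v where v: "v \<in> carrier_vec d" "v \<noteq> 0\<^sub>v d" "transpose_mat B *\<^sub>v v = 0\<^sub>v d"
      using det_0_iff_vec_prod_zero_field[of "transpose_mat B" d] B by auto
    have "(\<Sum>k<d. v $ k * z ^ (CARD('a) ^ k)) = 0" if "z \<in> adjoin x" for z
    proof -
      have "z \<in> ac.span (set bs)"
        using that by (simp add: span)
      then show ?thesis
      proof (induction rule: ac.span_induct_alt)
        case base
        show ?case by (simp add: zero_power)
      next
        case (step c b y)
        then obtain j where j: "j < d" "b = bs ! j"
          by (auto simp: in_set_conv_nth len)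
        have "(transpose_mat B *\<^sub>v v) $ j = (\<Sum>k<d. v $ k * b ^ (CARD('a) ^ k))"
          using j v(1) by (simp add: B_def scalar_prod_def atLeast0LessThan mult.commute)
        then have "(\<Sum>k<d. v $ k * b ^ (CARD('a) ^ k)) = 0"
          using v(3) j by simp
        moreover have "(\<Sum>k<d. v $ k * (to_ac c * b + y) ^ (CARD('a) ^ k)) =
          to_ac c * (\<Sum>k<d. v $ k * b ^ (CARD('a) ^ k)) + (\<Sum>k<d. v $ k * y ^ (CARD('a) ^ k))"
          by (simp add: frobenius_power_add power_mult_distrib to_ac_power_CARD_power
              algebra_simps sum.distrib sum_distrib_left)
        ultimately show ?case
          using step by simp
      qed
    qed
    then have "v $ k = 0" if "k < d" for k
      using frobenius_powers_independent[of "\<lambda>k. v $ k"] that by blast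
    then have "v = 0\<^sub>v d"
      using v(1) by (intro eq_vecI) auto
    then show False
      using v(2) by simp
  qed
  moreover have "det D = (\<Prod>k<d. x ^ (CARD('a) ^ k))"
  proof -
    have "upper_triangular D"
      by (auto simp: D_def)
    then show ?thesis
      using det_upper_triangular[OF _ D] by (simp add: prod_list_diag_prod D_def atLeast0LessThan)
  qed
  ultimately show ?thesis
    by (simp add: M_def)
qed

lemma norm_adjoin_eq_prod: "to_ac (norm_adjoin x) = (\<Prod>k<d. x ^ (CARD('a) ^ k))"
  unfolding norm_adjoin_def by (rule det_mult_matrix) (rule someI_ex[OF adjoin_basis_exists])

end

section \<open>Roots of unity and a square root of minus one\<close>

lemma inj_on_powers_of_root_of_unity:
  fixes g :: "'b::field"
  assumes "\<And>k. g ^ k = 1 \<longleftrightarrow> d dvd k" and "d > 0"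
  shows "inj_on (\<lambda>k. g ^ k) {..<d}"
proof (rule linorder_inj_onI')
  fix k l
  assume kl: "k \<in> {..<d}" "l \<in> {..<d}" "k < l"
  have "g \<noteq> 0"
    using assms by (metis dvd_refl power_eq_0_iff zero_neq_one)
  show "g ^ k \<noteq> g ^ l"
  proof
    assume "g ^ k = g ^ l"
    also have "\<dots> = g ^ k * g ^ (l - k)"
      using kl by (simp flip: power_add)
    finally have "g ^ (l - k) = 1"
      using \<open>g \<noteq> 0\<close> by simp
    then have "d dvd l - k"
      using assms(1) by simp
    then show False
      using kl dvd_imp_le[of d "l - k"] by auto
  qed
qed

text \<open>
  The homogeneous form of \<open>X\<^sup>d - 1 = \<Prod>\<^sub>k (X - g\<^sup>k)\<close>; it includes \<open>a = 0\<close>, which evaluates the product of the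
  roots of unity.
\<close>

lemma prod_roots_of_unity:
  fixes g a b :: "'b::field"
  assumes "\<And>k. g ^ k = 1 \<longleftrightarrow> d dvd k" and "d > 0"
  shows "(\<Prod>k<d. a - g ^ k * b) = a ^ d - b ^ d"
proof (cases "b = 0")
  case False
  let ?P = "\<Prod>k<d. [:- (g ^ k), 1:]"
  have inj: "inj_on (\<lambda>k. g ^ k) {..<d}"
    by (rule inj_on_powers_of_root_of_unity[OF assms])
  have deg: "degree ?P = d"
    by (subst degree_prod_eq_sum_degree) auto
  have "?P = monom 1 d - 1"
  proof (rule poly_eqI_degree_lead_coeff[where n = d and A = "(\<lambda>k. g ^ k) ` {..<d}"])
    have "lead_coeff ?P = 1"
      by (simp add: lead_coeff_prod)
    then show "coeff ?P d = coeff (monom 1 d - 1) d"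
      using assms(2) deg by simp
    show "degree ?P \<le> d"
      by (simp add: deg)
    show "degree (monom 1 d - 1 :: 'b poly) \<le> d"
      by (intro degree_diff_le order.trans[OF degree_monom_le]) auto
    fix z
    assume "z \<in> (\<lambda>k. g ^ k) ` {..<d}"
    then obtain k where k: "k < d" "z = g ^ k"
      by auto
    have "z ^ d = 1"
      using assms(1)[of "k * d"] by (simp add: k power_mult)
    moreover have "poly ?P z = 0"
      using k by (auto simp: poly_prod)
    ultimately show "poly ?P z = poly (monom 1 d - 1) z"
      by (simp add: poly_monom)
  qed (simp add: card_image inj)
  from arg_cong[OF this, of "\<lambda>p. poly p (a / b)"]
  have "(\<Prod>k<d. a / b - g ^ k) = (a / b) ^ d - 1"
    by (simp add: poly_prod poly_monom)
  moreover have "(\<Prod>k<d. a - g ^ k * b) = (\<Prod>k<d. b * (a / b - g ^ k))"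
    using False by (intro prod.cong) (auto simp: field_simps)
  ultimately have "(\<Prod>k<d. a - g ^ k * b) = b ^ d * ((a / b) ^ d - 1)"
    by (simp add: prod.distrib)
  also have "\<dots> = a ^ d - b ^ d"
    using False by (simp add: power_divide right_diff_distrib)
  finally show ?thesis .
qed (use assms(2) in \<open>simp add: power_0_left\<close>)

lemma power_eq_1_iff_mult_ord_dvd:
  fixes z :: "'b::field"
  assumes "mult_ord z > 0"
  shows "z ^ k = 1 \<longleftrightarrow> mult_ord z dvd k"
proof -
  interpret K: field "ring_of_type_algebra :: 'b ring"
    by (rule field_from_type_algebra)
  interpret G: group "Multiplicative_Group.mult_of (ring_of_type_algebra :: 'b ring)"
    by (rule K.field_mult_group)
  have pow: "y [^]\<^bsub>Multiplicative_Group.mult_of (ring_of_type_algebra :: 'b ring)\<^esub> (n::nat) = y ^ n"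
    for y :: 'b and n
    by (induction n) (simp_all add: ring_of_type_algebra_def nat_pow_def mult.commute)
  have one: "\<one>\<^bsub>Multiplicative_Group.mult_of (ring_of_type_algebra :: 'b ring)\<^esub> = (1::'b)"
    by (simp add: ring_of_type_algebra_def)
  \<comment> \<open>Zero lies outside the multiplicative group; the choice in the order function gives it order 0.\<close>
  have "z \<noteq> 0"
  proof
    assume "z = 0"
    then have "mult_ord z = (SOME d. \<forall>n. (0::'b) ^ n = 1 \<longleftrightarrow> d dvd n)"
      by (simp add: mult_ord_def G.ord_def pow one del: mult_of_simps)
    also have "\<dots> = 0"
    proof (rule some_equality)
      show "\<forall>n. (0::'b) ^ n = 1 \<longleftrightarrow> 0 dvd n"
        by (simp add: power_0_left)
      show "d = 0" if "\<forall>n. (0::'b) ^ n = 1 \<longleftrightarrow> d dvd n" for d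
        using that[rule_format, of d] by (simp add: power_0_left split: if_splits)
    qed
    finally show False
      using assms by simp
  qed
  then have "z \<in> carrier (Multiplicative_Group.mult_of (ring_of_type_algebra :: 'b ring))"
    by (simp add: ring_of_type_algebra_def)
  from G.pow_eq_id[OF this, of k] show ?thesis
    by (simp add: pow one mult_ord_def del: mult_of_simps)
qed

text \<open>
  The sign \<open>\<rho>(-1)\<close> is the factor by which Frobenius multiplies \<open>\<iota>\<close>. Since \<open>q - 1\<close> respectively \<open>q + 1\<close> is
  \<open>2 E\<close>, the corresponding power of \<open>\<iota>\<close> is both \<open>1\<close> and \<open>(-1)\<^sup>E\<close>, which makes \<open>E\<close> even.
\<close>

lemma E_param_cases:
  fixes \<iota> :: "'a::{field,finite} alg_closure"
  assumes odd: "odd CARD('a)" and \<iota>: "\<iota>\<^sup>2 = -1"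
  obtains E where "E_param TYPE('a) = int E" and "even E"
    and "CARD('a) = 2 * E + 1 \<and> \<iota> ^ CARD('a) = \<iota> \<or> CARD('a) + 1 = 2 * E \<and> \<iota> ^ CARD('a) = - \<iota>"
proof -
  have two: "(2 :: 'a alg_closure) \<noteq> 0"
    by (rule two_neq_0_if_odd_CARD[OF odd])
  then have neg: "(-1 :: 'a alg_closure) \<noteq> 1"
    by (metis one_add_one add.right_inverse)
  have "\<iota> \<noteq> 0"
    using \<iota> by auto
  show thesis
  proof (cases "is_square (-1 :: 'a)")
    case True
    then have fixed: "\<iota> ^ CARD('a) = \<iota>"
      using is_square_iff_root_frobenius_fixed[of \<iota> "-1"] \<iota> by simp
    obtain m where m: "CARD('a) = 2 * m + 1"
      using odd by (rule oddE)
    have "(-1) ^ m * \<iota> = \<iota>"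
      using fixed by (simp add: m power_mult \<iota>)
    then have "even m"
      using \<open>\<iota> \<noteq> 0\<close> neg by (auto simp: minus_one_power_iff split: if_splits)
    moreover have "E_param TYPE('a) = int m"
      using True by (simp add: E_param_def quad_char_def m)
    ultimately show thesis
      using that m fixed by blast
  next
    case False
    then have nfixed: "\<iota> ^ CARD('a) \<noteq> \<iota>"
      using is_square_iff_root_frobenius_fixed[of \<iota> "-1"] \<iota> by simp
    have "(\<iota> ^ CARD('a))\<^sup>2 = \<iota>\<^sup>2"
      using odd by (simp add: \<iota> power_mult[symmetric] mult.commute[of _ 2]) (simp add: power_mult \<iota>)
    then have conj: "\<iota> ^ CARD('a) = - \<iota>"
      using nfixed by (simp add: power2_eq_iff)
    obtain m where m: "CARD('a) + 1 = 2 * m"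
      using odd by (metis evenE odd_even_add odd_one)
    have "(-1) ^ m = \<iota> ^ (CARD('a) + 1)"
      by (simp only: m power_mult \<iota>)
    also have "\<dots> = - (\<iota>\<^sup>2)"
      by (simp add: conj power2_eq_square)
    finally have "even m"
      using neg by (auto simp: \<iota> minus_one_power_iff split: if_splits)
    moreover have "int CARD('a) + 1 = 2 * int m"
      using m by linarith
    then have "E_param TYPE('a) = int m"
      using False by (simp add: E_param_def quad_char_def)
    ultimately show thesis
      using that m conj by blast
  qed
qed

section \<open>A rational parametrisation that linearises the Frobenius map\<close>

text \<open>
  With \<open>W = w\<^sup>2\<close> and \<open>w = exp (i t)\<close> this is \<open>((w + w\<^sup>-\<^sup>1) / 2)\<^sup>2 = cos\<^sup>2 t\<close>. Writing it in terms of \<open>W\<close> keeps it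
  rational, and \<open>1 - x\<close> becomes the square of the sine.
\<close>

definition cosine_square :: "'b::field \<Rightarrow> 'b" where
  "cosine_square W = (W + 1)\<^sup>2 / (4 * W)"

lemma cosine_square_inverse:
  "(W::'b::field) \<noteq> 0 \<Longrightarrow> cosine_square (inverse W) = cosine_square W"
  by (cases "(4::'b) = 0") (simp_all add: cosine_square_def field_simps power2_eq_square)

lemma four_neq_0: "(2::'b::idom) \<noteq> 0 \<Longrightarrow> (4::'b) \<noteq> 0"
  by (metis mult_2 mult_eq_0_iff numeral_Bit0)

lemma cosine_square_eq_iff:
  fixes W Z :: "'b::field"
  assumes "(2::'b) \<noteq> 0" and "W \<noteq> 0" and "Z \<noteq> 0"
  shows "cosine_square W = cosine_square Z \<longleftrightarrow> W = Z \<or> W * Z = 1"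
proof -
  have four: "(4::'b) \<noteq> 0"
    by (rule four_neq_0[OF assms(1)])
  have "cosine_square W = cosine_square Z \<longleftrightarrow> (W + 1)\<^sup>2 * (4 * Z) = (Z + 1)\<^sup>2 * (4 * W)"
    using assms four by (simp add: cosine_square_def frac_eq_eq)
  also have "\<dots> \<longleftrightarrow> 4 * ((W - Z) * (W * Z - 1)) = 0"
    by (simp only: eq_iff_diff_eq_0[of "_ * _" "_ * _"]) (simp add: algebra_simps power2_eq_square)
  also have "\<dots> \<longleftrightarrow> W = Z \<or> W * Z = 1"
    using four by simp
  finally show ?thesis .
qed

lemma frobenius_numeral:
  "(numeral n :: 'a::{field,finite} alg_closure) ^ CARD('a) = numeral n"
  using to_ac_power_CARD[of "numeral n :: 'a"] by simp

lemma frobenius_diff: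
  fixes u v :: "'a::{field,finite} alg_closure"
  shows "(u - v) ^ CARD('a) = u ^ CARD('a) - v ^ CARD('a)"
  using frobenius_add[of "u - v" v] by simp

lemma frobenius_cosine_square:
  fixes Z :: "'a::{field,finite} alg_closure"
  shows "cosine_square Z ^ CARD('a) = cosine_square (Z ^ CARD('a))"
proof -
  have "((Z + 1)\<^sup>2) ^ CARD('a) = (Z ^ CARD('a) + 1)\<^sup>2"
    using frobenius_add[of Z 1] by (metis power_mult mult.commute power_one)
  then show ?thesis
    by (simp add: cosine_square_def power_divide power_mult_distrib frobenius_numeral)
qed

text \<open>
  For \<open>x = u\<^sup>2\<close> and \<open>1 - x = v\<^sup>2\<close> put \<open>w = u + \<iota> v\<close>, so that \<open>w\<^sup>-\<^sup>1 = u - \<iota> v\<close>. The exponent \<open>n = (q + 1) / 2\<close>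
  turns \<open>x\<^sup>n\<close> into \<open>u\<^sup>q u\<close>, and \<open>u\<^sup>q\<close>, \<open>v\<^sup>q\<close> are the cosine and (up to the sign of \<open>\<iota>\<^sup>q\<close>) the sine belonging to \<open>w\<^sup>q\<close>.
  By the addition theorem the sum is the cosine belonging to \<open>w\<^sup>q w\<^sup>-\<^sup>1\<close> if \<open>q = 2 E + 1\<close> and to \<open>w\<^sup>q w\<close> if
  \<open>q = 2 E - 1\<close>, and in both cases this product is \<open>W\<^sup>E\<close>.
\<close>

lemma cosine_square_paramE:
  fixes x \<iota> :: "'a::{field,finite} alg_closure"
  assumes odd: "odd CARD('a)" and \<iota>: "\<iota>\<^sup>2 = -1"
    and E: "CARD('a) = 2 * E + 1 \<and> \<iota> ^ CARD('a) = \<iota> \<or> CARD('a) + 1 = 2 * E \<and> \<iota> ^ CARD('a) = - \<iota>"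
  obtains W where "W \<noteq> 0" and "x = cosine_square W"
    and "x ^ ((CARD('a) + 1) div 2) + (1 - x) ^ ((CARD('a) + 1) div 2) = (W ^ E + inverse (W ^ E)) / 2"
proof -
  let ?q = "CARD('a)"
  have two: "(2 :: 'a alg_closure) \<noteq> 0"
    by (rule two_neq_0_if_odd_CARD[OF odd])
  obtain u where u: "u\<^sup>2 = x"
    using nth_root_exists[of 2 x] by auto
  obtain v where v: "v\<^sup>2 = 1 - x"
    using nth_root_exists[of 2 "1 - x"] by auto
  define w where "w = u + \<iota> * v"
  define i where "i = u - \<iota> * v"
  define h where "h = inverse (2 :: 'a alg_closure)"
  have h: "2 * h = 1"
    using two by (simp add: h_def)
  have wi: "w * i = 1"
  proof -
    have "w * i = u\<^sup>2 - \<iota>\<^sup>2 * v\<^sup>2"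
      by (simp add: w_def i_def power2_eq_square algebra_simps)
    then show ?thesis
      by (simp add: u v \<iota>)
  qed
  then have w0: "w \<noteq> 0" and i: "i = inverse w"
    by (auto simp: inverse_unique)
  have u_eq: "u = (w + i) * h"
  proof -
    have "(w + i) * h = u * (2 * h)"
      by (simp add: w_def i_def algebra_simps)
    then show ?thesis
      by (simp add: h)
  qed
  have v_eq: "v = - \<iota> * (w - i) * h"
  proof -
    have "- \<iota> * (w - i) * h = - (\<iota>\<^sup>2) * v * (2 * h)"
      by (simp add: w_def i_def power2_eq_square algebra_simps)
    then show ?thesis
      by (simp add: h \<iota>)
  qed
  define T where "T = (w\<^sup>2) ^ E"
  define t where "t = inverse T"
  have hq: "h ^ ?q = h"
    by (simp only: h_def power_inverse frobenius_numeral)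
  have uq: "u ^ ?q = (w ^ ?q + inverse (w ^ ?q)) * h"
    by (simp add: u_eq power_mult_distrib frobenius_add hq i power_inverse)
  have vq: "v ^ ?q = - (\<iota> ^ ?q) * (w ^ ?q - inverse (w ^ ?q)) * h"
    using odd by (simp add: v_eq power_mult_distrib frobenius_diff hq i power_inverse)
  have n: "2 * ((?q + 1) div 2) = Suc ?q"
    using odd by simp
  have sum: "x ^ ((?q + 1) div 2) + (1 - x) ^ ((?q + 1) div 2) = u ^ ?q * u + v ^ ?q * v"
    unfolding v[symmetric] unfolding u[symmetric] power_mult[symmetric] n by simp
  have half_trace: "u ^ ?q * u + v ^ ?q * v = (T + t) * h"
    using E
  proof (elim disjE conjE)
    assume q: "?q = 2 * E + 1" and \<iota>q: "\<iota> ^ ?q = \<iota>"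
    have wq: "w ^ ?q = T * w"
      by (simp add: q T_def power_mult)
    have wq': "inverse (w ^ ?q) = t * i"
      by (simp add: wq t_def i)
    have "u ^ ?q * u + v ^ ?q * v =
        h * h * ((T * w + t * i) * (w + i) + \<iota>\<^sup>2 * ((T * w - t * i) * (w - i)))"
      unfolding uq vq wq' unfolding wq \<iota>q u_eq v_eq by (simp add: power2_eq_square algebra_simps)
    also have "\<dots> = (w * i) * (2 * h) * (T + t) * h"
      by (simp add: \<iota> algebra_simps)
    finally show ?thesis
      by (simp add: wi h)
  next
    assume q: "?q + 1 = 2 * E" and \<iota>q: "\<iota> ^ ?q = - \<iota>"
    have "w ^ ?q * w = w ^ (?q + 1)"
      by simp
    also have "\<dots> = T"
      by (simp only: q T_def power_mult)
    finally have wq: "w ^ ?q = T * i"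
      using w0 by (simp add: i field_simps)
    have wq': "inverse (w ^ ?q) = t * w"
      by (simp add: wq t_def i)
    have "u ^ ?q * u + v ^ ?q * v =
        h * h * ((T * i + t * w) * (w + i) - \<iota>\<^sup>2 * ((T * i - t * w) * (w - i)))"
      unfolding uq vq wq' unfolding wq \<iota>q u_eq v_eq by (simp add: power2_eq_square algebra_simps)
    also have "\<dots> = (w * i) * (2 * h) * (T + t) * h"
      by (simp add: \<iota> algebra_simps)
    finally show ?thesis
      by (simp add: wi h)
  qed
  have x_eq: "x = cosine_square (w\<^sup>2)"
  proof -
    have "x * (4 * w\<^sup>2) = ((w * w + w * i) * (2 * h))\<^sup>2"
      unfolding u[symmetric] u_eq by (simp add: power2_eq_square algebra_simps)
    then have "(w\<^sup>2 + 1)\<^sup>2 = x * (4 * w\<^sup>2)"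
      by (simp add: wi h power2_eq_square)
    moreover have "4 * w\<^sup>2 \<noteq> 0"
      using four_neq_0[OF two] w0 by simp
    ultimately show ?thesis
      by (simp add: cosine_square_def field_simps)
  qed
  show thesis
  proof (rule that[OF _ x_eq])
    show "w\<^sup>2 \<noteq> 0"
      using w0 by simp
    show "x ^ ((?q + 1) div 2) + (1 - x) ^ ((?q + 1) div 2) =
        ((w\<^sup>2) ^ E + inverse ((w\<^sup>2) ^ E)) / 2"
      by (simp only: sum half_trace T_def t_def h_def divide_inverse)
  qed
qed

text \<open>
  Since \<open>W\<^bsup>2 E\<^esup>\<close> is the root of unity \<open>\<gamma> = (W\<^sup>E)\<^sup>2\<close>, Frobenius multiplies \<open>W\<close> by \<open>\<gamma>\<close> if \<open>q = 2 E + 1\<close> and, up to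
  inversion, by \<open>\<gamma>\<^sup>-\<^sup>1\<close> if \<open>q = 2 E - 1\<close>; the parameter of \<open>x\<close> matters only up to inversion. Two conjugates
  could coincide without equal parameters only if \<open>g\<^sup>j W\<^sup>2 = 1\<close> for some \<open>j\<close>, and the \<open>E\<close>-th power of this says
  \<open>\<gamma> = 1\<close>.
\<close>

lemma frobenius_orbit_cosine_square:
  fixes W :: "'a::{field,finite} alg_closure"
  assumes odd: "odd CARD('a)" and E: "CARD('a) = 2 * E + 1 \<or> CARD('a) + 1 = 2 * E"
    and W: "W \<noteq> 0" and d: "d > 1" "d dvd E"
    and ord: "\<And>k. ((W ^ E)\<^sup>2) ^ k = 1 \<longleftrightarrow> d dvd k"
  obtains g where "\<And>k. g ^ k = 1 \<longleftrightarrow> d dvd k"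
    and "\<And>k. cosine_square W ^ (CARD('a) ^ k) = cosine_square (g ^ k * W)"
    and "frobenius_orbit (cosine_square W) d"
proof -
  let ?q = "CARD('a)"
  define \<gamma> where "\<gamma> = (W ^ E)\<^sup>2"
  define g where "g = (if ?q = 2 * E + 1 then \<gamma> else inverse \<gamma>)"
  have \<gamma>0: "\<gamma> \<noteq> 0"
    using W by (simp add: \<gamma>_def)
  then have g0: "g \<noteq> 0"
    by (simp add: g_def)
  have g: "g ^ k = 1 \<longleftrightarrow> d dvd k" for k
    using ord[of k] by (simp add: g_def power_inverse flip: \<gamma>_def)
  have gkE: "(g ^ k) ^ (2 * E) = 1" for k
    using d(2) by (simp add: g flip: power_mult)
  have WE: "W ^ (2 * E) = \<gamma>"
    by (simp add: \<gamma>_def mult.commute flip: power_mult)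
  have ZE: "(g ^ k * W) ^ (2 * E) = \<gamma>" for k
    by (simp only: power_mult_distrib gkE WE) simp
  have step: "cosine_square (g ^ k * W) ^ ?q = cosine_square (g ^ Suc k * W)" for k
    using E
  proof
    assume q: "?q = 2 * E + 1"
    then have "(g ^ k * W) ^ ?q = g ^ Suc k * W"
      using ZE[of k] by (simp add: g_def mult_ac)
    then show ?thesis
      by (simp only: frobenius_cosine_square)
  next
    assume q: "?q + 1 = 2 * E"
    have "(g ^ k * W) ^ ?q * (g ^ k * W) = (g ^ k * W) ^ (?q + 1)"
      by simp
    also have "\<dots> = inverse g"
      unfolding q ZE using q by (simp add: g_def)
    finally have "(g ^ k * W) ^ ?q * (g ^ k * W) = inverse g" .
    moreover have "(g ^ k * W) ^ ?q * (g ^ Suc k * W) = (g ^ k * W) ^ ?q * (g ^ k * W) * g"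
      by (simp add: mult_ac)
    ultimately have "(g ^ k * W) ^ ?q * (g ^ Suc k * W) = 1"
      using g0 by simp
    then have "(g ^ k * W) ^ ?q = inverse (g ^ Suc k * W)"
      using inverse_unique mult.commute by metis
    then show ?thesis
      using W g0 by (simp only: frobenius_cosine_square cosine_square_inverse mult_eq_0_iff
        power_eq_0_iff simp_thms)
  qed
  have conj: "cosine_square W ^ (?q ^ k) = cosine_square (g ^ k * W)" for k
  proof (induction k)
    case (Suc k)
    have "cosine_square W ^ (?q ^ Suc k) = (cosine_square W ^ (?q ^ k)) ^ ?q"
      by (simp add: mult.commute flip: power_mult)
    then show ?case
      by (simp only: Suc step)
  qed simp
  have "frobenius_orbit (cosine_square W) d"
  proof
    show "d > 0"
      using d by simp
    show "cosine_square W ^ (?q ^ d) = cosine_square W"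
      using g[of d] by (simp add: conj)
    show "inj_on (\<lambda>k. cosine_square W ^ (?q ^ k)) {..<d}"
    proof (rule inj_onI)
      fix k l
      assume k: "k \<in> {..<d}" and l: "l \<in> {..<d}"
        and "cosine_square W ^ (?q ^ k) = cosine_square W ^ (?q ^ l)"
      then have "g ^ k * W = g ^ l * W \<or> (g ^ k * W) * (g ^ l * W) = 1"
        using cosine_square_eq_iff[OF two_neq_0_if_odd_CARD[OF odd]] W g0 by (simp add: conj)
      moreover have "(g ^ k * W) * (g ^ l * W) \<noteq> 1"
      proof
        assume "(g ^ k * W) * (g ^ l * W) = 1"
        then have "g ^ (k + l) * W\<^sup>2 = 1"
          by (simp add: power_add power2_eq_square mult_ac)
        then have "(g ^ (k + l) * W\<^sup>2) ^ E = 1"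
          by simp
        moreover have "(W\<^sup>2) ^ E = (W ^ E)\<^sup>2"
          by (simp only: mult_ac flip: power_mult)
        moreover have "(g ^ (k + l)) ^ E = 1"
          using d(2) by (simp add: g flip: power_mult)
        ultimately show False
          using ord[of 1] d(1) by (simp add: power_mult_distrib)
      qed
      ultimately have "g ^ k = g ^ l"
        using W by simp
      then show "k = l"
        using inj_on_powers_of_root_of_unity[OF g] d(1) k l by (auto dest: inj_onD)
    qed
  qed
  then show thesis
    using that g conj by blast
qed

text \<open>
  The conjugates \<open>(1 + g\<^sup>k W)\<^sup>2 / (4 g\<^sup>k W)\<close> multiply to \<open>(1 - V)\<^sup>2 / (4\<^sup>d (- V))\<close> with \<open>V = (- W)\<^sup>d\<close>. This is the
  square of \<open>M = (1 - V) / (2\<^sup>d U)\<close> for a square root \<open>U\<close> of \<open>- V\<close>, and \<open>U\<^bsup>2 E\<^esup> = (- V)\<^sup>E = (W\<^sup>E)\<^sup>d\<close>, so Frobenius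
  multiplies \<open>M\<close> by this last sign.
\<close>

lemma is_square_norm_cosine_square_iff:
  fixes W :: "'a::{field,finite} alg_closure"
  assumes odd: "odd CARD('a)" and E: "CARD('a) = 2 * E + 1 \<or> CARD('a) + 1 = 2 * E"
    and "even E" and W: "W \<noteq> 0" and d: "d > 1" "d dvd E"
    and ord: "\<And>k. ((W ^ E)\<^sup>2) ^ k = 1 \<longleftrightarrow> d dvd k"
  shows "is_square (norm_adjoin (cosine_square W)) \<longleftrightarrow> (W ^ E) ^ d = 1"
proof -
  let ?q = "CARD('a)"
  obtain g where g: "\<And>k. g ^ k = 1 \<longleftrightarrow> d dvd k"
    and conj: "\<And>k. cosine_square W ^ (?q ^ k) = cosine_square (g ^ k * W)"
    and orbit: "frobenius_orbit (cosine_square W) d"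
    using frobenius_orbit_cosine_square[OF odd E W d ord] by blast
  interpret frobenius_orbit "cosine_square W" d
    by (rule orbit)
  have two: "(2 :: 'a alg_closure) \<noteq> 0"
    by (rule two_neq_0_if_odd_CARD[OF odd])
  define V where "V = (- W) ^ d"
  define c where "c = (W ^ E) ^ d"
  obtain U where U: "U\<^sup>2 = - V"
    using nth_root_exists[of 2 "- V"] by auto
  define M where "M = (1 - V) / (2 ^ d * U)"
  have V0: "V \<noteq> 0"
    using W by (simp add: V_def)
  then have U0: "U \<noteq> 0"
    using U by auto
  have "(\<Prod>k<d. 1 + g ^ k * W) = 1 - V"
    using prod_roots_of_unity[of g d 1 "- W"] g d(1) by (simp add: V_def)
  moreover have "(\<Prod>k<d. g ^ k * W) = - V"
    using prod_roots_of_unity[of g d 0 "- W"] g d(1) by (simp add: V_def power_0_left)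
  moreover have "to_ac (norm_adjoin (cosine_square W)) =
      (\<Prod>k<d. 1 + g ^ k * W)\<^sup>2 / (4 ^ d * (\<Prod>k<d. g ^ k * W))"
    unfolding norm_adjoin_eq_prod conj
    by (simp add: cosine_square_def prod_dividef prod.distrib add.commute flip: prod_power_distrib)
  ultimately have norm: "to_ac (norm_adjoin (cosine_square W)) = (1 - V)\<^sup>2 / (4 ^ d * - V)"
    by simp
  also have "(4 :: 'a alg_closure) ^ d = (2 ^ d)\<^sup>2"
    by (simp add: power2_eq_square flip: power_mult_distrib)
  finally have M2: "M\<^sup>2 = to_ac (norm_adjoin (cosine_square W))"
    by (simp add: M_def power_divide power_mult_distrib U)
  have c2: "c\<^sup>2 = 1"
  proof -
    have "c\<^sup>2 = ((W ^ E)\<^sup>2) ^ d"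
      unfolding c_def by (simp only: mult_ac flip: power_mult)
    then show ?thesis
      using ord[of d] by simp
  qed
  then have inv_c: "inverse c = c"
    by (metis inverse_unique power2_eq_square)
  have VE: "V ^ E = c"
  proof -
    have "V ^ E = ((- W) ^ E) ^ d"
      unfolding V_def by (simp only: mult_ac flip: power_mult)
    then show ?thesis
      using \<open>even E\<close> by (simp add: c_def)
  qed
  have UE: "U ^ (2 * E) = c"
    using \<open>even E\<close> VE by (simp add: power_mult U)
  have V2E: "V ^ (2 * E) = 1"
    using c2 by (simp only: mult.commute[of 2] power_mult VE)
  have "(2 ^ d) ^ ?q = (2 ^ d :: 'a alg_closure)"
  proof -
    have "(2 ^ d) ^ ?q = ((2 :: 'a alg_closure) ^ ?q) ^ d"
      by (simp only: mult_ac flip: power_mult)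
    then show ?thesis
      by (simp only: frobenius_numeral)
  qed
  then have Mq: "M ^ ?q = (1 - V ^ ?q) / (2 ^ d * U ^ ?q)"
    by (simp add: M_def power_divide power_mult_distrib frobenius_diff)
  have "M ^ ?q = c * M"
    using E
  proof
    assume q: "?q = 2 * E + 1"
    have Vq: "V ^ ?q = V" and Uq: "U ^ ?q = c * U"
      by (simp_all add: q UE V2E)
    show ?thesis
      unfolding Mq Vq Uq unfolding M_def by (simp add: divide_inverse inv_c mult_ac)
  next
    assume q: "?q + 1 = 2 * E"
    have "V ^ ?q * V = 1" "U ^ ?q * U = c"
      using V2E UE unfolding q[symmetric] by (simp_all add: mult.commute)
    then have Vq: "V ^ ?q = 1 / V" and Uq: "U ^ ?q = c / U"
      using V0 U0 by (simp_all add: field_simps)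
    have "M ^ ?q = c * ((1 - 1 / V) * U / 2 ^ d)"
      unfolding Mq Vq Uq by (simp add: divide_inverse inv_c mult_ac)
    also have "(1 - 1 / V) * U = (1 - V) * U / U\<^sup>2"
      using V0 by (simp add: U field_simps)
    also have "\<dots> = (1 - V) / U"
      using U0 by (simp add: power2_eq_square)
    finally show ?thesis
      by (simp add: M_def)
  qed
  \<comment> \<open>The value of c can be read off from the action on M only if M is not zero.\<close>
  moreover have "V \<noteq> 1"
  proof
    assume "V = 1"
    then have "V ^ (E div d) = 1"
      by simp
    then have "W ^ E = 1"
      using d(2) \<open>even E\<close> by (simp add: V_def flip: power_mult)
    then show False
      using ord[of 1] d(1) by simp
  qed
  then have "M \<noteq> 0"
    using two U0 by (simp add: M_def)
  ultimately have "M ^ ?q = M \<longleftrightarrow> c = 1"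
    by simp
  then show ?thesis
    using is_square_iff_root_frobenius_fixed[OF M2] by (simp add: c_def)
qed

section \<open>The zeros of the polynomials\<close>

lemma map_poly_to_ac_mult: "map_poly to_ac (p * r) = map_poly to_ac p * map_poly to_ac r"
  by (rule poly_eqI) (simp add: coeff_map_poly coeff_mult to_ac_sum)

lemma map_poly_to_ac_power: "map_poly to_ac (p ^ k) = map_poly to_ac p ^ k"
  by (induction k) (simp_all add: map_poly_to_ac_mult)

lemma g_zero_iff:
  fixes s :: "'a::{field,finite}"
  shows "g_zero s x \<longleftrightarrow>
    x ^ ((CARD('a) + 1) div 2) + (1 - x) ^ ((CARD('a) + 1) div 2) = to_ac s"
proof -
  let ?n = "(CARD('a) + 1) div 2"
  have "map_poly to_ac (g_poly s) =
      map_poly to_ac ([:0, 1:] ^ ?n) + map_poly to_ac ((1 - [:0, 1:]) ^ ?n) - map_poly to_ac [:s:]"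
    unfolding g_poly_def Let_def by (rule poly_eqI) (simp add: coeff_map_poly)
  also have "\<dots> = [:0, 1:] ^ ?n + [:1, -1:] ^ ?n - [:to_ac s:]"
    by (simp only: map_poly_to_ac_power) (simp add: map_poly_pCons one_pCons)
  finally show ?thesis
    by simp
qed

lemma add_inverse_eq_iff:
  fixes a b :: "'b::field"
  assumes "a \<noteq> 0" and "b \<noteq> 0"
  shows "a + inverse a = b + inverse b \<longleftrightarrow> a = b \<or> a = inverse b"
proof -
  have "(a - b) * (a * b - 1) = a * b * ((a + inverse a) - (b + inverse b))"
    using assms by (simp add: field_simps)
  then have "a + inverse a = b + inverse b \<longleftrightarrow> a = b \<or> a * b = 1"
    using assms by (metis mult_eq_0_iff right_minus_eq)
  then show ?thesis
    using assms by (simp add: field_simps)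
qed

text \<open>
  In the parameter \<open>W\<close>, a zero of \<open>g\<^sub>s\<close> is given by \<open>W\<^sup>E = \<beta>\<close> or \<open>W\<^sup>E = \<beta>\<^sup>-\<^sup>1\<close>. Prescribing the order of
  \<open>\<beta>\<^sup>2\<close>, which does not see the sign of \<open>\<beta>\<close>, lets the result apply to \<open>s\<close> and \<open>- s\<close> alike.
\<close>

lemma is_square_norm_g_zero:
  fixes \<iota> \<beta> :: "'a::{field,finite} alg_closure"
  assumes odd: "odd CARD('a)" and \<iota>: "\<iota>\<^sup>2 = -1" and d: "d > 1" "int d dvd E_param TYPE('a)"
    and ord: "\<And>k. (\<beta>\<^sup>2) ^ k = 1 \<longleftrightarrow> d dvd k"
    and s: "to_ac s = (\<beta> + inverse \<beta>) / 2" and x: "g_zero s x"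
  shows "is_square (norm_adjoin x) \<longleftrightarrow> \<beta> ^ d = 1"
proof -
  have two: "(2 :: 'a alg_closure) \<noteq> 0"
    by (rule two_neq_0_if_odd_CARD[OF odd])
  obtain E where E: "E_param TYPE('a) = int E" "even E"
    "CARD('a) = 2 * E + 1 \<and> \<iota> ^ CARD('a) = \<iota> \<or> CARD('a) + 1 = 2 * E \<and> \<iota> ^ CARD('a) = - \<iota>"
    using E_param_cases[OF odd \<iota>] by blast
  obtain W where W: "W \<noteq> 0" "x = cosine_square W"
    "x ^ ((CARD('a) + 1) div 2) + (1 - x) ^ ((CARD('a) + 1) div 2) = (W ^ E + inverse (W ^ E)) / 2"
    using cosine_square_paramE[OF odd \<iota> E(3)] by blast
  have \<beta>0: "\<beta> \<noteq> 0"
    using ord[of d] d(1) by (auto simp: power_0_left)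
  have "W ^ E + inverse (W ^ E) = \<beta> + inverse \<beta>"
  proof -
    have "(W ^ E + inverse (W ^ E)) / 2 = (\<beta> + inverse \<beta>) / 2"
      using x by (simp only: g_zero_iff W(3) s)
    then show ?thesis
      using two by simp
  qed
  then have T: "W ^ E = \<beta> \<or> W ^ E = inverse \<beta>"
    using W(1) \<beta>0 by (simp add: add_inverse_eq_iff)
  have "is_square (norm_adjoin (cosine_square W)) \<longleftrightarrow> (W ^ E) ^ d = 1"
  proof (rule is_square_norm_cosine_square_iff)
    show "((W ^ E)\<^sup>2) ^ k = 1 \<longleftrightarrow> d dvd k" for k
      using T ord[of k] by (auto simp: power_inverse)
    show "d dvd E"
      using d(2) by (simp add: E(1))
  qed (use odd E W(1) d(1) in auto)
  also have "\<dots> \<longleftrightarrow> \<beta> ^ d = 1"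
    using T by (auto simp: power_inverse)
  finally show ?thesis
    by (simp add: W(2))
qed

theorem theorem5p1:
  fixes s :: "'a::{field,finite}" and \<iota> \<zeta> :: "'a alg_closure" and d :: nat
  assumes "odd CARD('a)"
    and "\<iota>\<^sup>2 = -1"
    and "d > 2" and "int d dvd E_param TYPE('a)"
    and "\<zeta> \<in> adjoin \<iota>" and "mult_ord \<zeta> = 2 * d"
    and "s \<in> B_set \<zeta> d"
  shows "(\<forall>x. g_zero s x \<longrightarrow> \<not> is_square (norm_adjoin x)) \<and>
         (odd d \<longrightarrow> (\<forall>x. g_zero (- s) x \<longrightarrow> is_square (norm_adjoin x)))"
proof -
  obtain j where j: "coprime j (2 * d)" and s: "to_ac s = (\<zeta> ^ j + inverse \<zeta> ^ j) / 2"
    using assms(7) by (auto simp: B_set_def)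
  define \<beta> where "\<beta> = \<zeta> ^ j"
  have \<beta>: "\<beta> ^ k = 1 \<longleftrightarrow> 2 * d dvd k" for k
    using power_eq_1_iff_mult_ord_dvd[of \<zeta> "j * k"] assms(3,6) j
    by (simp add: \<beta>_def power_mult coprime_dvd_mult_right_iff coprime_commute)
  \<comment> \<open>The order of \<beta> is 2 d, so \<beta> ^ d is the sign -1 and, for odd d, (- \<beta>) ^ d is 1.\<close>
  have ord: "(\<beta>\<^sup>2) ^ k = 1 \<longleftrightarrow> d dvd k" for k
    using \<beta>[of "2 * k"] by (simp add: power_mult)
  have "\<beta> ^ d \<noteq> 1"
    using \<beta>[of d] assms(3) by (auto dest: dvd_imp_le)
  moreover have "(\<beta> ^ d)\<^sup>2 = 1"
    using \<beta>[of "d * 2"] by (simp add: power_mult mult.commute)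
  ultimately have \<beta>d: "\<beta> ^ d = -1"
    by (simp add: power2_eq_1_iff)
  have s_eq: "to_ac s = (\<beta> + inverse \<beta>) / 2"
    by (simp add: s \<beta>_def power_inverse)
  have d1: "d > 1"
    using assms(3) by simp
  have "\<not> is_square (norm_adjoin x)" if "g_zero s x" for x
    using is_square_norm_g_zero[OF assms(1,2) d1 assms(4) ord s_eq that] \<open>\<beta> ^ d \<noteq> 1\<close> by simp
  moreover have "is_square (norm_adjoin x)" if "odd d" "g_zero (- s) x" for x
  proof -
    have "to_ac (- s) = (- \<beta> + inverse (- \<beta>)) / 2"
      by (simp add: s_eq add_divide_distrib)
    then show ?thesis
      using is_square_norm_g_zero[of \<iota> d "- \<beta>" "- s" x] assms(1,2,4) d1 ord that \<beta>d by simp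
  qed
  ultimately show ?thesis
    by blast
qed

end
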